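(* Let $a,b,c>0$ and $p$ be real numbers, let $\mathcal{F}_p(x)=(1-x)^pF(a,b;c;x)$, and let $u_n=u_n(p)$ be its Maclaurin coefficients, i.e. $\mathcal{F}_p(x)=\sum_{n=0}^\infty u_n x^n$. Put $$p_*=\frac12+\frac{ab}{c}-\sqrt{\frac14+\frac{ab(c-a)(c-b)}{c^2(c+1)}},\qquad p^*=\frac12+\frac{ab}{c}+\sqrt{\frac14+\frac{ab(c-a)(c-b)}{c^2(c+1)}}.$$ For an integer $n\ge0$ and $x\in(0,1)$ consider the double inequalities $$\text{(A)}\quad \frac{\sum_{j=0}^nu_jx^j-\left(\sum_{j=0}^nu_j\right)x^{n+1}}{(1-x)^p}<F(a,b;c;x)<\frac{\sum_{j=0}^{n+1}u_jx^j}{(1-x)^p},$$ $$\text{(B)}\quad \frac{\sum_{j=0}^{n+1}u_jx^j}{(1-x)^p}<F(a,b;c;x)<\frac{\sum_{j=0}^nu_jx^j-\left(\sum_{j=0}^nu_j\right)x^{n+1}}{(1-x)^p}.$$ If $c\ge a+b$: - if $\frac{ab}{c}\le p\le1$, then (A) holds for all $x\in(0,1)$ and all $n\ge0$; - if $p_*\le p\le1$, then (A) holds for all $x\in(0,1)$ and all $n\ge1$; - if $p^*\le p\le2$, then (B) holds for all $x\in(0,1)$ and all $n\ge1$. If $\max\{a,b\}<c<a+b$: - if $\frac{ab}{c}\le p\le a+b+1-c$, then (A) holds for all $x\in(0,1)$ and all $n\ge0$; - if $p_*\le p\le a+b+1-c$, then (A) holds for all $x\in(0,1)$ and all $n\ge1$;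 - if $p^*\le p\le a+b+2-c$, then (B) holds for all $x\in(0,1)$ and all $n\ge1$.
   Context: $F(a,b;c;x)=\sum_{n=0}^\infty\frac{(a)_n(b)_n}{(c)_n}\frac{x^n}{n!}$ is the Gaussian hypergeometric function, with $(a)_0=1$ and $(a)_n=a(a+1)\cdots(a+n-1)$ for $n\ge1$. *)

theory Defs
  imports "HOL-Computational_Algebra.Formal_Power_Series" "HOL-Analysis.Analysis"
begin

definition gauss_F :: "real \<Rightarrow> real \<Rightarrow> real \<Rightarrow> real \<Rightarrow> real" where
  "gauss_F a b c x =
     (\<Sum>n. (pochhammer a n * pochhammer b n) / pochhammer c n * (x ^ n / fact n))"

text \<open>The underlying formal power series is the library's generalised hypergeometric series.\<close>

lemma gauss_F_eq_eval_fps: "gauss_F a b c x = eval_fps (fps_hypergeo [a, b] [c] 1) x"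
  by (simp add: gauss_F_def eval_fps_def)

definition weighted_F :: "real \<Rightarrow> real \<Rightarrow> real \<Rightarrow> real \<Rightarrow> real \<Rightarrow> real" where
  "weighted_F a b c p x = (1 - x) powr p * gauss_F a b c x"

definition maclaurin_coeff :: "(real \<Rightarrow> real) \<Rightarrow> nat \<Rightarrow> real" where
  "maclaurin_coeff f n = (deriv ^^ n) f 0 / fact n"

definition u_coeff :: "real \<Rightarrow> real \<Rightarrow> real \<Rightarrow> real \<Rightarrow> nat \<Rightarrow> real" where
  "u_coeff a b c p = maclaurin_coeff (weighted_F a b c p)"

definition p_lower :: "real \<Rightarrow> real \<Rightarrow> real \<Rightarrow> real" where
  "p_lower a b c =
     1 / 2 + a * b / c - sqrt (1 / 4 + a * b * (c - a) * (c - b) / (c\<^sup>2 * (c + 1)))"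

definition p_upper :: "real \<Rightarrow> real \<Rightarrow> real \<Rightarrow> real" where
  "p_upper a b c =
     1 / 2 + a * b / c + sqrt (1 / 4 + a * b * (c - a) * (c - b) / (c\<^sup>2 * (c + 1)))"

definition bound_partial :: "real \<Rightarrow> real \<Rightarrow> real \<Rightarrow> real \<Rightarrow> nat \<Rightarrow> real \<Rightarrow> real" where
  "bound_partial a b c p n x =
     (\<Sum>j\<le>n + 1. u_coeff a b c p j * x ^ j) / (1 - x) powr p"

definition bound_corrected :: "real \<Rightarrow> real \<Rightarrow> real \<Rightarrow> real \<Rightarrow> nat \<Rightarrow> real \<Rightarrow> real" where
  "bound_corrected a b c p n x =
     ((\<Sum>j\<le>n. u_coeff a b c p j * x ^ j) - (\<Sum>j\<le>n. u_coeff a b c p j) * x ^ (n + 1))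
       / (1 - x) powr p"

definition ineq_A :: "real \<Rightarrow> real \<Rightarrow> real \<Rightarrow> real \<Rightarrow> nat \<Rightarrow> real \<Rightarrow> bool" where
  "ineq_A a b c p n x \<longleftrightarrow>
     bound_corrected a b c p n x < gauss_F a b c x \<and>
     gauss_F a b c x < bound_partial a b c p n x"

definition ineq_B :: "real \<Rightarrow> real \<Rightarrow> real \<Rightarrow> real \<Rightarrow> nat \<Rightarrow> real \<Rightarrow> bool" where
  "ineq_B a b c p n x \<longleftrightarrow>
     bound_partial a b c p n x < gauss_F a b c x \<and>
     gauss_F a b c x < bound_corrected a b c p n x"

end

theory Submission
  imports Defs
begin

text \<open>
  Write \<open>G\<^sub>p = (1 - X)\<^sup>p F(a, b; c; X)\<close> for the formal power series with coefficients
  \<open>u\<^sub>n(p)\<close>.  Since \<open>G\<^sub>p = (1 - X) G\<^bsub>p-1\<^esub>\<close>, the partial sums of the coefficients of \<open>G\<^sub>p\<close> are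
  the coefficients of \<open>G\<^bsub>p-1\<^esub>\<close>, and the two bounds around \<open>F\<close> turn out to be of the same kind:
  one is a Maclaurin polynomial of \<open>G\<^sub>p\<close> divided by \<open>(1 - x)\<^sup>p\<close>, the other, after summation by
  parts, is a Maclaurin polynomial of \<open>G\<^bsub>p-1\<^esub>\<close> divided by \<open>(1 - x)\<^bsup>p-1\<^esup>\<close>
  (\<open>bound_corrected_eq\<close>).  Every inequality therefore follows once the tails of the sequences
  \<open>u\<^sub>j(p)\<close> and \<open>u\<^sub>j(p - 1)\<close> have constant, opposite signs.

  The signs come from one identity.  The hypergeometric operator with parameters
  \<open>a - p, b - p, c\<close> maps \<open>G\<^sub>p\<close> to \<open>- p (p + c - a - b) G\<^bsub>p-1\<^esub>\<close> (\<open>weighted_fps_ode\<close>); on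
  coefficients,
  \<open>(n + 1)(n + c) u\<^bsub>n+1\<^esub>(p) = (n + a - p)(n + b - p) u\<^sub>n(p) - p (p + c - a - b) u\<^sub>n(p - 1)\<close>.
  Once the factors are positive, a constant sign of \<open>u\<^sub>n(p - 1)\<close> makes the opposite sign of
  \<open>u\<^sub>n(p)\<close> propagate from \<open>n\<close> to \<open>n + 1\<close>.

  For (A), \<open>p - 1\<close> is at most \<open>max 0 (a + b - c)\<close>, and then \<open>u\<^sub>n(p - 1) > 0\<close>: if
  \<open>p - 1 \<le> 0\<close>, both factors of \<open>G\<^bsub>p-1\<^esub>\<close> have nonnegative coefficients, and otherwise this
  applies after Euler's transformation
  \<open>u\<^sub>n(a, b, c, p) = u\<^sub>n(c - a, c - b, c, p + c - a - b)\<close>.  So \<open>u\<^sub>n(p) \<le> 0\<close> propagates,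
  starting from \<open>u\<^sub>1(p) = a b / c - p\<close> or from \<open>u\<^sub>2(p)\<close>, a quadratic in \<open>p\<close> with roots
  \<open>p\<^sub>*\<close> and \<open>p\<^sup>*\<close>.  For (B), what was just said applies to \<open>p - 1\<close> and yields
  \<open>u\<^sub>n(p - 1) < 0\<close>, so that now \<open>u\<^sub>n(p) \<ge> 0\<close> propagates from \<open>u\<^sub>2(p) \<ge> 0\<close>.

  Euler's transformation also explains why the two ranges of \<open>c\<close> are one: it leaves the
  coefficients and the relation between \<open>p\<close> and \<open>p\<^sub>*, p\<^sup>*\<close> unchanged and exchanges
  \<open>c > a + b\<close> with \<open>c < a + b\<close>.  The proof treats both at once, with
  \<open>1 + max 0 (a + b - c)\<close> as the upper end of the range of \<open>p\<close> in (A).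
\<close>

unbundle no vec_syntax
unbundle fps_syntax

section \<open>The weighted hypergeometric series\<close>

text \<open>The formal series \<open>(1 - X)\<^sup>p\<close>, with \<open>n\<close>-th coefficient \<open>(-p)\<^sub>n / n!\<close>.\<close>

abbreviation one_minus_X_powr :: "real \<Rightarrow> real fps" where
  "one_minus_X_powr p \<equiv> fps_hypergeo [- p] [] 1"

definition weighted_fps :: "real \<Rightarrow> real \<Rightarrow> real \<Rightarrow> real \<Rightarrow> real fps" where
  "weighted_fps a b c p = one_minus_X_powr p * fps_hypergeo [a, b] [c] 1"

lemma one_minus_X_powr_step:
  "one_minus_X_powr p = (1 - fps_X) * one_minus_X_powr (p - 1)"
proof (rule fps_ext)
  fix n
  show "one_minus_X_powr p $ n = ((1 - fps_X) * one_minus_X_powr (p - 1)) $ n"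
  proof (cases n)
    case (Suc m)
    define M where "M = real m + 1"
    have M: "M \<noteq> 0" "fact (Suc m) = M * fact m" "real m = M - 1"
      by (auto simp: M_def)
    have "pochhammer (- p) (Suc m) = - p * pochhammer (1 - p) m"
      by (simp add: pochhammer_rec)
    moreover have "pochhammer (1 - p) (Suc m) = pochhammer (1 - p) m * (M - p)"
      by (simp add: pochhammer_Suc M_def)
    ultimately show ?thesis
      using Suc M by (simp add: left_diff_distrib divide_simps del: fact_Suc)
        (simp add: algebra_simps)
  qed simp
qed

lemma fps_deriv_one_minus_X_powr:
  "fps_deriv (one_minus_X_powr p) = fps_const (- p) * one_minus_X_powr (p - 1)"
proof (rule fps_ext)
  fix n
  define M where "M = real n + 1"
  have "M \<noteq> 0" "fact (Suc n) = M * fact n" by (auto simp: M_def)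
  then show "fps_deriv (one_minus_X_powr p) $ n
      = (fps_const (- p) * one_minus_X_powr (p - 1)) $ n"
    by (simp add: pochhammer_rec M_def[symmetric] add.commute[of 1] del: fact_Suc)
qed

lemma weighted_fps_step: "weighted_fps a b c p = (1 - fps_X) * weighted_fps a b c (p - 1)"
  unfolding weighted_fps_def by (subst one_minus_X_powr_step) (simp add: mult_ac)

lemma weighted_fps_0 [simp]: "weighted_fps a b c p $ 0 = 1"
  by (simp add: weighted_fps_def)

lemma weighted_fps_diff:
  "weighted_fps a b c p $ Suc n =
     weighted_fps a b c (p - 1) $ Suc n - weighted_fps a b c (p - 1) $ n"
  by (subst weighted_fps_step) (simp add: left_diff_distrib)

lemma sum_weighted_fps:
  "(\<Sum>j\<le>n. weighted_fps a b c p $ j) = weighted_fps a b c (p - 1) $ n"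
  by (induction n) (simp_all add: weighted_fps_diff[of a b c p])

section \<open>Differential equation and recurrence\<close>

lemma fps_hypergeo_ode:
  fixes a b c :: real
  assumes "c > 0"
  defines "H \<equiv> fps_hypergeo [a, b] [c] 1"
  shows "fps_X * (1 - fps_X) * fps_deriv (fps_deriv H)
           + (fps_const c - fps_const (a + b + 1) * fps_X) * fps_deriv H
           - fps_const (a * b) * H = 0"
proof (rule fps_ext)
  fix n
  have rec: "(real n + 1) * (c + n) * H $ Suc n = (a + n) * (b + n) * H $ n" for n
  proof -
    have "real n + 1 \<noteq> 0" "c + n \<noteq> 0" using assms(1) by linarith+
    then show ?thesis
      using fps_hypergeo_rec[of "[a, b]" "[c]" 1 n]
      by (simp add: H_def add.commute del: fps_hypergeo_nth)
  qed
  show "(fps_X * (1 - fps_X) * fps_deriv (fps_deriv H)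
           + (fps_const c - fps_const (a + b + 1) * fps_X) * fps_deriv H
           - fps_const (a * b) * H) $ n = 0 $ n"
  proof (cases n)
    case 0
    then show ?thesis using rec[of 0]
      by (simp add: algebra_simps del: fps_hypergeo_nth)
  next
    case (Suc m)
    then show ?thesis using rec[of "Suc m"]
      by (cases m) (simp_all add: mult.assoc left_diff_distrib, simp_all add: algebra_simps)
  qed
qed

text \<open>
  Multiplying a solution of the hypergeometric equation by \<open>(1 - X)\<^sup>p\<close> shifts the exponents at
  \<open>1\<close> and at infinity, so the outcome nearly solves the equation with \<open>a - p\<close> and \<open>b - p\<close> in
  place of \<open>a\<close> and \<open>b\<close>.  At \<open>1\<close>, however, the exponents \<open>0\<close> and \<open>c - a - b\<close> become \<open>p\<close> and
  \<open>p + c - a - b\<close>, whereas a hypergeometric equation has \<open>0\<close> as an exponent there.  Hence the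
  product of the new exponents appears as a defect, with a factor \<open>(1 - X)\<^sup>p / (1 - X)\<close>.
\<close>

lemma weighted_fps_ode:
  fixes a b c p :: real
  assumes "c > 0"
  defines "G \<equiv> weighted_fps a b c p"
  shows "fps_X * (1 - fps_X) * fps_deriv (fps_deriv G)
           + (fps_const c - fps_const (a + b + 1 - 2 * p) * fps_X) * fps_deriv G
           - fps_const ((a - p) * (b - p)) * G
         = - fps_const (p * (p + c - a - b)) * weighted_fps a b c (p - 1)"
proof -
  define H where "H = fps_hypergeo [a, b] [c] (1::real)"
  define R where "R = one_minus_X_powr (p - 2)"
  define Q where "Q = one_minus_X_powr (p - 1)"
  define P where "P = one_minus_X_powr p"
  have Q: "Q = (1 - fps_X) * R" and P: "P = (1 - fps_X) * Q"
    using one_minus_X_powr_step[of p] one_minus_X_powr_step[of "p - 1"]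
    by (simp_all add: P_def Q_def R_def)
  have dP: "fps_deriv P = - fps_const p * Q" and dQ: "fps_deriv Q = fps_const (1 - p) * R"
    using fps_deriv_one_minus_X_powr[of p] fps_deriv_one_minus_X_powr[of "p - 1"]
    by (simp_all add: P_def Q_def R_def fps_const_neg[symmetric] del: fps_const_neg)
  have G: "G = P * H" and V: "weighted_fps a b c (p - 1) = Q * H"
    by (simp_all add: G_def weighted_fps_def P_def Q_def H_def)
  have G': "fps_deriv G = P * fps_deriv H - fps_const p * Q * H"
    by (simp add: G dP algebra_simps del: fps_const_neg)
  have G'': "fps_deriv (fps_deriv G) = P * fps_deriv (fps_deriv H)
      - 2 * fps_const p * Q * fps_deriv H - fps_const p * fps_const (1 - p) * R * H"
    by (simp add: G' dP dQ algebra_simps del: fps_const_neg fps_const_mult fps_const_sub)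
  have H: "fps_X * (1 - fps_X) * fps_deriv (fps_deriv H)
           + (fps_const c - (fps_const a + fps_const b + 1) * fps_X) * fps_deriv H
           - fps_const a * fps_const b * H = 0"
    using fps_hypergeo_ode[OF assms(1), of a b] by (simp add: H_def flip: fps_const_add)
  have const_eqs: "fps_const (a + b + 1 - 2 * p) = fps_const a + fps_const b + 1 - 2 * fps_const p"
    "fps_const ((a - p) * (b - p)) = (fps_const a - fps_const p) * (fps_const b - fps_const p)"
    "fps_const (p * (p + c - a - b)) =
       fps_const p * (fps_const p + fps_const c - fps_const a - fps_const b)"
    "fps_const (1 - p) = 1 - fps_const p"
    by (simp_all add: fps_const_mult[symmetric] flip: numeral_fps_const
          del: fps_const_mult)
  (* In terms of R, H and the derivatives of H, the difference of both sides is
     P times the hypergeometric equation of H. *)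
  show ?thesis
    unfolding G'' unfolding G' V const_eqs unfolding G P Q using H by algebra
qed

lemma weighted_fps_rec:
  assumes "c > 0"
  shows "(real n + 1) * (n + c) * weighted_fps a b c p $ Suc n =
           (n + a - p) * (n + b - p) * weighted_fps a b c p $ n
           - p * (p + c - a - b) * weighted_fps a b c (p - 1) $ n"
proof -
  define G where "G = weighted_fps a b c p"
  have "(fps_X * (1 - fps_X) * fps_deriv (fps_deriv G)
           + (fps_const c - fps_const (a + b + 1 - 2 * p) * fps_X) * fps_deriv G
           - fps_const ((a - p) * (b - p)) * G) $ n
         = (- fps_const (p * (p + c - a - b)) * weighted_fps a b c (p - 1)) $ n"
    using weighted_fps_ode[OF assms, of a b p] by (simp only: G_def)
  then show ?thesis
  proof (cases n)
    case 0
    with \<open>_ $ n = _ $ n\<close> show ?thesis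
      by (simp add: G_def algebra_simps)
  next
    case (Suc m)
    with \<open>_ $ n = _ $ n\<close> show ?thesis
      unfolding G_def[symmetric]
      by (cases m) (simp_all add: mult.assoc left_diff_distrib, simp_all add: algebra_simps)
  qed
qed

lemma weighted_fps_1:
  assumes "c > 0"
  shows "weighted_fps a b c p $ 1 = a * b / c - p"
  using weighted_fps_rec[OF assms, of 0 a b p] assms by (simp add: field_simps)

section \<open>Euler's transformation\<close>

text \<open>
  The recurrence determines \<open>u\<^bsub>n+1\<^esub>(p)\<close> from \<open>u\<^sub>n(p)\<close> and \<open>u\<^sub>n(p - 1) = u\<^sub>0(p) + \<dots> + u\<^sub>n(p)\<close>, and
  its coefficients do not change under \<open>(a, b, p) \<mapsto> (c - a, c - b, p + c - a - b)\<close>.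
\<close>

theorem weighted_fps_euler:
  assumes "c > 0"
  shows "weighted_fps (c - a) (c - b) c (p + c - a - b) = weighted_fps a b c p"
proof (rule fps_ext)
  fix n
  show "weighted_fps (c - a) (c - b) c (p + c - a - b) $ n = weighted_fps a b c p $ n"
  proof (induction n rule: less_induct)
    case (less n)
    show ?case
    proof (cases n)
      case (Suc m)
      define p' where "p' = p + c - a - b"
      have IH: "weighted_fps (c - a) (c - b) c p' $ k = weighted_fps a b c p $ k" if "k \<le> m" for k
        using less that Suc by (simp add: p'_def)
      have IH': "weighted_fps (c - a) (c - b) c (p' - 1) $ m = weighted_fps a b c (p - 1) $ m"
        unfolding sum_weighted_fps[symmetric] by (intro sum.cong) (auto simp: IH)
      have "(real m + 1) * (m + c) * weighted_fps (c - a) (c - b) c p' $ Suc m =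
          (real m + 1) * (m + c) * weighted_fps a b c p $ Suc m"
        unfolding weighted_fps_rec[OF assms] IH' IH[OF order.refl]
        by (simp add: p'_def algebra_simps)
      moreover have "real m + 1 \<noteq> 0" "real m + c \<noteq> 0"
        using assms by linarith+
      ultimately show ?thesis
        using Suc by (auto simp: p'_def)
    qed simp
  qed
qed

section \<open>Signs of the coefficients\<close>

lemma weighted_fps_pos_of_nonpos:
  assumes "a > 0" "b > 0" "c > 0" "q \<le> 0"
  shows "weighted_fps a b c q $ n > 0"
proof -
  have "pochhammer (- q) i \<ge> 0" for i
    unfolding pochhammer_prod using assms by (intro prod_nonneg) auto
  then have "one_minus_X_powr q $ i \<ge> 0" for i
    by simp
  moreover have "fps_hypergeo [a, b] [c] 1 $ i > 0" for i
    using assms by (simp add: pochhammer_pos)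
  ultimately have "0 < one_minus_X_powr q $ 0 * fps_hypergeo [a, b] [c] 1 $ n
      \<and> (\<forall>i. 0 \<le> one_minus_X_powr q $ i * fps_hypergeo [a, b] [c] 1 $ (n - i))"
    by (simp add: less_imp_le del: fps_hypergeo_nth)
  then show ?thesis
    unfolding weighted_fps_def fps_mult_nth
    by (intro sum_pos2[of _ 0]) auto
qed

lemma weighted_fps_pos:
  assumes "0 < a" "a < c" "0 < b" "b < c" "q \<le> max 0 (a + b - c)"
  shows "weighted_fps a b c q $ n > 0"
proof (cases "q \<le> 0")
  case True
  then show ?thesis using assms by (intro weighted_fps_pos_of_nonpos) auto
next
  case False
  then have "weighted_fps (c - a) (c - b) c (q + c - a - b) $ n > 0"
    using assms by (intro weighted_fps_pos_of_nonpos) auto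
  then show ?thesis using assms by (simp add: weighted_fps_euler)
qed

text \<open>
  The case where \<open>u\<^sub>n(p - 1)\<close> is positive and drives \<open>u\<^sub>n(p)\<close> downwards.  The lower bound on \<open>p\<close>
  makes \<open>p (p + c - a - b)\<close> positive, the upper one \<open>n + a - p\<close> and \<open>n + b - p\<close> for \<open>n \<ge> 1\<close>.
\<close>

lemma weighted_fps_neg_Suc:
  assumes "0 < a" "a < c" "0 < b" "b < c"
    and p: "max 0 (a + b - c) < p" "p \<le> 1 + max 0 (a + b - c)"
    and n: "n \<ge> 1" "weighted_fps a b c p $ n \<le> 0"
  shows "weighted_fps a b c p $ Suc n < 0"
proof -
  have "real n \<ge> 1" using n by simp
  then have "(n + a - p) * (n + b - p) > 0"
    using assms by (intro mult_pos_pos) auto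
  then have "(n + a - p) * (n + b - p) * weighted_fps a b c p $ n \<le> 0"
    using n by (simp add: mult_nonneg_nonpos)
  moreover have "p * (p + c - a - b) * weighted_fps a b c (p - 1) $ n > 0"
    using assms by (intro mult_pos_pos weighted_fps_pos) auto
  ultimately have "(real n + 1) * (n + c) * weighted_fps a b c p $ Suc n < 0"
    using assms by (subst weighted_fps_rec) auto
  moreover have "(real n + 1) * (n + c) > 0"
    using assms by (intro mult_pos_pos) auto
  ultimately show ?thesis by (metis mult_less_cancel_left_pos mult_zero_right)
qed

lemma weighted_fps_neg:
  assumes "0 < a" "a < c" "0 < b" "b < c"
    and "max 0 (a + b - c) < p" "p \<le> 1 + max 0 (a + b - c)"
    and "m \<ge> 1" "weighted_fps a b c p $ m \<le> 0" "n \<ge> Suc m"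
  shows "weighted_fps a b c p $ n < 0"
  using \<open>n \<ge> Suc m\<close>
proof (induction n rule: nat_induct_at_least)
  case base
  then show ?case using assms by (intro weighted_fps_neg_Suc) auto
next
  case (Suc n)
  then show ?case using assms by (intro weighted_fps_neg_Suc) auto
qed

text \<open>
  The number \<open>max 0 (a + b - c)\<close> is the order of growth of \<open>F\<close> at \<open>1\<close>, up to a logarithm; the
  conditions on \<open>p\<close> place it on the side where the factors of the recurrence are positive.
  The inequality with \<open>a + b - c\<close> is \<open>(c - a) (c - b) > 0\<close> divided by \<open>c\<close>.
\<close>

lemma growth_exponent_less:
  fixes a b c :: real
  assumes "0 < a" "a < c" "0 < b" "b < c"
  shows "max 0 (a + b - c) < a * b / c"
proof -
  have "(c - a) * (c - b) > 0" using assms by simp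
  then show ?thesis using assms by (simp add: field_simps)
qed

text \<open>
  The case where \<open>u\<^sub>n(p - 1)\<close> is negative and drives \<open>u\<^sub>n(p)\<close> upwards.  The recurrence has to
  start at \<open>n = 2\<close>, where \<open>n + a - p\<close> and \<open>n + b - p\<close> are nonnegative although \<open>p\<close> may exceed \<open>1\<close>
  by as much as \<open>1 + max 0 (a + b - c)\<close>.
\<close>

lemma weighted_fps_pos_above:
  assumes abc: "0 < a" "a < c" "0 < b" "b < c"
    and p: "a * b / c \<le> p - 1" "p \<le> 2 + max 0 (a + b - c)"
    and u2: "weighted_fps a b c p $ 2 \<ge> 0" and "n \<ge> 3"
  shows "weighted_fps a b c p $ n > 0"
proof -
  have gap: "max 0 (a + b - c) < p - 1"
    using growth_exponent_less[OF abc] p by linarith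
  have neg: "weighted_fps a b c (p - 1) $ k < 0" if "k \<ge> 2" for k
    using abc gap p that weighted_fps_1[of c a b "p - 1"]
    by (intro weighted_fps_neg[where m = 1]) auto
  have step: "weighted_fps a b c p $ Suc k > 0"
    if "k \<ge> 2" "weighted_fps a b c p $ k \<ge> 0" for k
  proof -
    have "real k \<ge> 2" using that by simp
    then have "(k + a - p) * (k + b - p) \<ge> 0"
      using abc p by (intro mult_nonneg_nonneg) auto
    moreover have "p * (p + c - a - b) * weighted_fps a b c (p - 1) $ k < 0"
      using gap that by (intro mult_pos_neg mult_pos_pos neg) auto
    ultimately have "(real k + 1) * (k + c) * weighted_fps a b c p $ Suc k > 0"
      using abc that by (subst weighted_fps_rec) (auto intro: less_le_trans)
    moreover have "(real k + 1) * (k + c) > 0"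
      using abc by (intro mult_pos_pos) auto
    ultimately show ?thesis by (metis mult_less_cancel_left_pos mult_zero_right)
  qed
  show ?thesis
    using \<open>n \<ge> 3\<close>
  proof (induction n rule: nat_induct_at_least)
    case base
    then show ?case using step[of 2] u2 by (simp add: numeral_3_eq_3 numeral_2_eq_2)
  next
    case (Suc n)
    then show ?case using step[of n] by simp
  qed
qed

text \<open>The numbers \<open>p\<^sub>*\<close> and \<open>p\<^sup>*\<close> are the zeros of \<open>u\<^sub>2(p)\<close>.\<close>

lemma weighted_fps_2:
  assumes "0 < a" "a < c" "0 < b" "b < c"
  shows "weighted_fps a b c p $ 2 = (p - p_lower a b c) * (p - p_upper a b c) / 2"
proof -
  define r where "r = 1 / 4 + a * b * (c - a) * (c - b) / (c\<^sup>2 * (c + 1))"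
  have "r \<ge> 0" using assms by (simp add: r_def)
  have "(p - p_lower a b c) * (p - p_upper a b c) = (p - (1 / 2 + a * b / c))\<^sup>2 - (sqrt r)\<^sup>2"
    unfolding p_lower_def p_upper_def r_def[symmetric] by algebra
  also have "\<dots> = (p - (1 / 2 + a * b / c))\<^sup>2 - r"
    using \<open>r \<ge> 0\<close> by simp
  finally have roots: "(p - p_lower a b c) * (p - p_upper a b c) = (p - (1 / 2 + a * b / c))\<^sup>2 - r" .
  have "2 * (1 + c) * weighted_fps a b c p $ 2 =
      (1 + a - p) * (1 + b - p) * (a * b / c - p) - p * (p + c - a - b) * (a * b / c - p + 1)"
    using weighted_fps_rec[of c 1 a b p] weighted_fps_1[of c a b p]
      weighted_fps_1[of c a b "p - 1"] assms by (simp add: numeral_2_eq_2)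
  also have "\<dots> = (1 + c) * ((p - (1 / 2 + a * b / c))\<^sup>2 - r)"
    using assms unfolding r_def by (simp add: divide_simps) algebra
  finally have "(1 + c) * (2 * weighted_fps a b c p $ 2)
      = (1 + c) * ((p - (1 / 2 + a * b / c))\<^sup>2 - r)"
    by (simp only: mult_ac)
  then have "2 * weighted_fps a b c p $ 2 = (p - (1 / 2 + a * b / c))\<^sup>2 - r"
    by (rule mult_left_cancel[THEN iffD1, rotated]) (use assms in simp)
  then show ?thesis unfolding roots by simp
qed

lemma
  assumes "0 < a" "a < c" "0 < b" "b < c"
  shows p_lower_le_quotient: "p_lower a b c \<le> a * b / c"
    and quotient_le_p_upper: "1 + a * b / c \<le> p_upper a b c"
proof -
  have "sqrt (1 / 4) \<le> sqrt (1 / 4 + a * b * (c - a) * (c - b) / (c\<^sup>2 * (c + 1)))"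
    using assms by (intro real_sqrt_le_mono) simp
  then show "p_lower a b c \<le> a * b / c" "1 + a * b / c \<le> p_upper a b c"
    by (simp_all add: p_lower_def p_upper_def real_sqrt_divide)
qed

text \<open>
  Both \<open>0\<close> and \<open>a + b - c\<close> lie below \<open>p\<^sub>*\<close>, because at these points \<open>G\<^sub>p\<close> has positive
  coefficients, in particular \<open>u\<^sub>2(p) > 0\<close>, and both are smaller than \<open>p\<^sup>*\<close>.
\<close>

lemma growth_exponent_less_p_lower:
  assumes "0 < a" "a < c" "0 < b" "b < c"
  shows "max 0 (a + b - c) < p_lower a b c"
proof -
  let ?d = "max 0 (a + b - c)"
  have "(?d - p_lower a b c) * (?d - p_upper a b c) > 0"
    using weighted_fps_pos[OF assms order.refl, of 2] weighted_fps_2[OF assms, of ?d] by linarith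
  moreover have "?d - p_upper a b c < 0"
    using quotient_le_p_upper[OF assms] growth_exponent_less[OF assms] by linarith
  ultimately show ?thesis by (simp add: zero_less_mult_iff)
qed

section \<open>From formal to convergent series\<close>

lemma binomial_series:
  fixes a x :: real
  assumes "\<bar>x\<bar> < 1"
  shows "(\<lambda>n. pochhammer a n / fact n * x ^ n) sums (1 - x) powr (- a)"
proof -
  have "(- a gchoose n) * (- x) ^ n = pochhammer a n / fact n * x ^ n" for n
    by (simp add: gbinomial_pochhammer power_minus[of x])
  then show ?thesis using gen_binomial_real[of "- x" "- a"] assms by simp
qed

lemma fps_conv_radius_one_minus_X_powr: "fps_conv_radius (one_minus_X_powr p) \<ge> 1"
  unfolding fps_conv_radius_def
proof (rule conv_radius_geI_ex')
  fix r :: real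
  assume "0 < r" "ereal r < 1"
  then show "summable (\<lambda>n. one_minus_X_powr p $ n * of_real r ^ n)"
    using binomial_series[of r "- p"] by (simp add: sums_iff)
qed

lemma eval_one_minus_X_powr:
  "\<bar>x\<bar> < 1 \<Longrightarrow> eval_fps (one_minus_X_powr p) x = (1 - x) powr p"
  using binomial_series[of x "- p"] by (simp add: eval_fps_def sums_iff)

lemma fps_conv_radius_hypergeo:
  fixes a b c :: real
  assumes "0 < a" "0 < b" "b \<le> c"
  shows "fps_conv_radius (fps_hypergeo [a, b] [c] 1) \<ge> 1"
  unfolding fps_conv_radius_def
proof (rule conv_radius_geI_ex')
  fix r :: real
  assume r: "0 < r" "ereal r < 1"
  have "pochhammer b n \<le> pochhammer c n" for n
    unfolding pochhammer_prod using assms by (intro prod_mono) auto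
  then have "pochhammer b n / pochhammer c n \<le> 1" for n
    using assms by (simp add: pochhammer_pos)
  then have bound: "norm (fps_hypergeo [a, b] [c] 1 $ n * of_real r ^ n)
      \<le> pochhammer a n / fact n * r ^ n" for n
    using assms r mult_left_mono[of "pochhammer b n / pochhammer c n" 1
        "pochhammer a n / fact n * r ^ n"]
    by (simp add: abs_mult pochhammer_nonneg mult_ac)
  have "summable (\<lambda>n. pochhammer a n / fact n * r ^ n)"
    using binomial_series[of r a] r by (simp add: sums_iff)
  then show "summable (\<lambda>n. fps_hypergeo [a, b] [c] 1 $ n * of_real r ^ n)"
    by (rule summable_comparison_test'[where N = 0]) (rule bound)
qed

lemma eval_weighted_fps:
  assumes "0 < a" "0 < b" "b \<le> c"
  shows "fps_conv_radius (weighted_fps a b c p) \<ge> 1"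
    and "\<bar>x\<bar> < 1 \<Longrightarrow> eval_fps (weighted_fps a b c p) x = weighted_F a b c p x"
proof -
  note radii = fps_conv_radius_one_minus_X_powr[of p] fps_conv_radius_hypergeo[OF assms]
  then show "fps_conv_radius (weighted_fps a b c p) \<ge> 1"
    unfolding weighted_fps_def using fps_conv_radius_mult order.trans by (metis min.bounded_iff)
  assume x: "\<bar>x\<bar> < 1"
  then have "ereal (norm x) < 1" by (simp add: one_ereal_def)
  with radii have "ereal (norm x) < fps_conv_radius (one_minus_X_powr p)"
    "ereal (norm x) < fps_conv_radius (fps_hypergeo [a, b] [c] 1)"
    by (blast intro: less_le_trans)+
  then show "eval_fps (weighted_fps a b c p) x = weighted_F a b c p x"
    unfolding weighted_fps_def weighted_F_def using x
    by (simp add: eval_fps_mult eval_one_minus_X_powr gauss_F_eq_eval_fps)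
qed

lemma maclaurin_coeff_eval_fps:
  assumes "fps_conv_radius F > 0"
  shows "maclaurin_coeff (eval_fps F) n = F $ n"
  using assms
proof (induction n arbitrary: F)
  case 0
  then show ?case by (simp add: maclaurin_coeff_def eval_fps_at_0)
next
  case (Suc n F)
  have "eventually (\<lambda>z. z \<in> eball 0 (fps_conv_radius F)) (nhds 0)"
    using Suc.prems by (intro eventually_nhds_in_open) (auto simp: zero_ereal_def)
  then have "eventually (\<lambda>z. deriv (eval_fps F) z = eval_fps (fps_deriv F) z) (nhds 0)"
    by eventually_elim (simp add: eval_fps_deriv)
  then have "(deriv ^^ Suc n) (eval_fps F) 0 = (deriv ^^ n) (eval_fps (fps_deriv F)) 0"
    unfolding funpow_Suc_right o_def by (intro higher_deriv_cong_ev refl)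
  moreover have "maclaurin_coeff (eval_fps (fps_deriv F)) n = fps_deriv F $ n"
    using Suc.prems fps_conv_radius_deriv[of F] by (intro Suc.IH) (rule less_le_trans)
  ultimately show ?case
    by (simp add: maclaurin_coeff_def field_simps del: of_nat_Suc)
qed

lemma u_coeff_eq_weighted_fps:
  assumes "0 < a" "0 < b" "b \<le> c"
  shows "u_coeff a b c p n = weighted_fps a b c p $ n"
proof -
  have "eventually (\<lambda>x. x \<in> ball 0 1) (nhds (0::real))"
    by (intro eventually_nhds_in_open) auto
  then have "eventually (\<lambda>x. weighted_F a b c p x = eval_fps (weighted_fps a b c p) x) (nhds 0)"
    by eventually_elim (simp add: eval_weighted_fps(2)[OF assms])
  then have "u_coeff a b c p n = maclaurin_coeff (eval_fps (weighted_fps a b c p)) n"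
    unfolding u_coeff_def maclaurin_coeff_def by (simp cong: higher_deriv_cong_ev)
  also have "\<dots> = weighted_fps a b c p $ n"
    using eval_weighted_fps(1)[OF assms, of p]
    by (intro maclaurin_coeff_eval_fps) (auto intro: less_le_trans[of 0 1])
  finally show ?thesis .
qed

section \<open>Truncations and the two bounds\<close>

definition truncated_F :: "real \<Rightarrow> real \<Rightarrow> real \<Rightarrow> real \<Rightarrow> nat \<Rightarrow> real \<Rightarrow> real" where
  "truncated_F a b c p n x = (\<Sum>j\<le>n. weighted_fps a b c p $ j * x ^ j) / (1 - x) powr p"

lemma bound_partial_eq:
  assumes "0 < a" "0 < b" "b \<le> c"
  shows "bound_partial a b c p n x = truncated_F a b c p (n + 1) x"
  by (simp add: bound_partial_def truncated_F_def u_coeff_eq_weighted_fps[OF assms])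

text \<open>Summation by parts, since \<open>u\<^sub>n(p - 1)\<close> is the partial sum \<open>u\<^sub>0(p) + \<dots> + u\<^sub>n(p)\<close>.\<close>

lemma bound_corrected_eq:
  assumes "0 < a" "0 < b" "b \<le> c" "x < 1"
  shows "bound_corrected a b c p n x = truncated_F a b c (p - 1) n x"
proof -
  have "(\<Sum>j\<le>n. weighted_fps a b c p $ j * x ^ j) - weighted_fps a b c (p - 1) $ n * x ^ (n + 1)
      = (1 - x) * (\<Sum>j\<le>n. weighted_fps a b c (p - 1) $ j * x ^ j)"
    by (induction n) (simp_all add: weighted_fps_diff[of a b c p] algebra_simps)
  moreover have "(1 - x) powr p = (1 - x) * (1 - x) powr (p - 1)"
    using assms by (simp add: powr_diff)
  ultimately show ?thesis
    using assms by (simp add: bound_corrected_def truncated_F_def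
        u_coeff_eq_weighted_fps sum_weighted_fps)
qed

lemma truncated_F_less:
  assumes "0 < a" "0 < b" "b \<le> c" and x: "x \<in> {0<..<1}"
    and pos: "\<And>j. j > n \<Longrightarrow> weighted_fps a b c p $ j > 0"
  shows "truncated_F a b c p n x < gauss_F a b c x"
proof -
  let ?f = "\<lambda>j. weighted_fps a b c p $ j * x ^ j"
  have "ereal (norm x) < fps_conv_radius (weighted_fps a b c p)"
    using x eval_weighted_fps(1)[OF assms(1-3), of p]
    by (auto intro: less_le_trans[of _ 1] simp: one_ereal_def)
  then have "?f sums weighted_F a b c p x"
    using sums_eval_fps eval_weighted_fps(2)[OF assms(1-3), of x p] x by fastforce
  then have "(\<Sum>j\<le>n. ?f j) < weighted_F a b c p x"
    using sum_less_suminf[of ?f "Suc n"] pos x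
    by (simp add: sums_iff lessThan_Suc_atMost)
  then show ?thesis
    using x by (simp add: truncated_F_def weighted_F_def field_simps)
qed

lemma truncated_F_greater:
  assumes "0 < a" "0 < b" "b \<le> c" and x: "x \<in> {0<..<1}"
    and neg: "\<And>j. j > n \<Longrightarrow> weighted_fps a b c p $ j < 0"
  shows "gauss_F a b c x < truncated_F a b c p n x"
proof -
  let ?f = "\<lambda>j. - (weighted_fps a b c p $ j * x ^ j)"
  have "ereal (norm x) < fps_conv_radius (weighted_fps a b c p)"
    using x eval_weighted_fps(1)[OF assms(1-3), of p]
    by (auto intro: less_le_trans[of _ 1] simp: one_ereal_def)
  then have "?f sums - weighted_F a b c p x"
    using sums_minus[OF sums_eval_fps] eval_weighted_fps(2)[OF assms(1-3), of x p] x by fastforce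
  then have "(\<Sum>j\<le>n. ?f j) < - weighted_F a b c p x"
    using sum_less_suminf[of ?f "Suc n"] neg x
    by (simp add: sums_iff lessThan_Suc_atMost mult_neg_pos)
  then show ?thesis
    using x by (simp add: truncated_F_def weighted_F_def sum_negf field_simps)
qed

section \<open>The double inequalities\<close>

text \<open>
  For \<open>n \<ge> 1\<close> the tail of \<open>u\<^sub>j(p)\<close> only involves \<open>j \<ge> 3\<close>, so \<open>u\<^sub>2(p) \<le> 0\<close> suffices to start the
  propagation of signs.  For \<open>n = 0\<close> it has to start at \<open>u\<^sub>1(p) = a b / c - p\<close>.
\<close>

lemma ineq_A_if:
  assumes abc: "0 < a" "a < c" "0 < b" "b < c"
    and p: "p \<le> 1 + max 0 (a + b - c)"
    and start: "n \<ge> 1 \<and> p_lower a b c \<le> p \<or> a * b / c \<le> p" and x: "x \<in> {0<..<1}"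
  shows "ineq_A a b c p n x"
proof -
  have lower: "p_lower a b c \<le> p"
    using start p_lower_le_quotient[OF abc] by linarith
  then have gap: "max 0 (a + b - c) < p"
    using growth_exponent_less_p_lower[OF abc] by linarith
  have "p \<le> p_upper a b c"
    using growth_exponent_less[OF abc] quotient_le_p_upper[OF abc] p by linarith
  then have u2: "weighted_fps a b c p $ 2 \<le> 0"
    using lower by (simp add: weighted_fps_2[OF abc] mult_nonneg_nonpos)
  have "weighted_fps a b c p $ j < 0" if "j > n + 1" for j
  proof (cases "n \<ge> 1")
    case True
    then show ?thesis
      using that by (intro weighted_fps_neg[OF abc gap p _ u2]) auto
  next
    case False
    then have "weighted_fps a b c p $ 1 \<le> 0"
      using start abc weighted_fps_1[of c a b p] by simp
    then show ?thesis
      using that by (intro weighted_fps_neg[OF abc gap p order.refl]) auto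
  qed
  moreover have "weighted_fps a b c (p - 1) $ j > 0" for j
    using p by (intro weighted_fps_pos[OF abc]) auto
  ultimately show ?thesis
    using abc x by (auto simp: ineq_A_def bound_partial_eq bound_corrected_eq
        intro!: truncated_F_less truncated_F_greater)
qed

text \<open>
  Since \<open>p\<^sup>* - 1 \<ge> a b / c\<close>, the sequence \<open>u\<^sub>j(p - 1)\<close> is in the situation of the previous lemma, with
  \<open>u\<^sub>1(p - 1) \<le> 0\<close>.
\<close>

lemma ineq_B_if:
  assumes abc: "0 < a" "a < c" "0 < b" "b < c"
    and p: "p_upper a b c \<le> p" "p \<le> 2 + max 0 (a + b - c)"
    and n: "n \<ge> 1" and x: "x \<in> {0<..<1}"
  shows "ineq_B a b c p n x"
proof -
  have p1: "a * b / c \<le> p - 1" "p_lower a b c \<le> p"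
    using p_lower_le_quotient[OF abc] quotient_le_p_upper[OF abc] p by linarith+
  then have gap: "max 0 (a + b - c) < p - 1"
    using growth_exponent_less[OF abc] by linarith
  have "weighted_fps a b c p $ 2 \<ge> 0"
    using p p1 by (simp add: weighted_fps_2[OF abc])
  then have "weighted_fps a b c p $ j > 0" if "j > n + 1" for j
    using that n by (intro weighted_fps_pos_above[OF abc p1(1) p(2)]) auto
  moreover have "weighted_fps a b c (p - 1) $ j < 0" if "j > n" for j
    using that n abc p p1 gap weighted_fps_1[of c a b "p - 1"]
    by (intro weighted_fps_neg[where m = 1]) auto
  ultimately show ?thesis
    using abc x by (auto simp: ineq_B_def bound_partial_eq bound_corrected_eq
        intro!: truncated_F_less truncated_F_greater)
qed

theorem proposition3:
  fixes a b c p :: real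
  assumes "a > 0" and "b > 0" and "c > 0"
  shows "(c \<ge> a + b \<longrightarrow>
            (a * b / c \<le> p \<and> p \<le> 1 \<longrightarrow>
               (\<forall>n. \<forall>x\<in>{0<..<1}. ineq_A a b c p n x)) \<and>
            (p_lower a b c \<le> p \<and> p \<le> 1 \<longrightarrow>
               (\<forall>n\<ge>1. \<forall>x\<in>{0<..<1}. ineq_A a b c p n x)) \<and>
            (p_upper a b c \<le> p \<and> p \<le> 2 \<longrightarrow>
               (\<forall>n\<ge>1. \<forall>x\<in>{0<..<1}. ineq_B a b c p n x))) \<and>
         (max a b < c \<and> c < a + b \<longrightarrow>
            (a * b / c \<le> p \<and> p \<le> a + b + 1 - c \<longrightarrow>
               (\<forall>n. \<forall>x\<in>{0<..<1}. ineq_A a b c p n x)) \<and>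
            (p_lower a b c \<le> p \<and> p \<le> a + b + 1 - c \<longrightarrow>
               (\<forall>n\<ge>1. \<forall>x\<in>{0<..<1}. ineq_A a b c p n x)) \<and>
            (p_upper a b c \<le> p \<and> p \<le> a + b + 2 - c \<longrightarrow>
               (\<forall>n\<ge>1. \<forall>x\<in>{0<..<1}. ineq_B a b c p n x)))"
proof -
  have A: "ineq_A a b c p n x"
    if "a < c" "b < c" "p \<le> 1 + max 0 (a + b - c)" "x \<in> {0<..<1}"
      "n \<ge> 1 \<and> p_lower a b c \<le> p \<or> a * b / c \<le> p" for n x
    using that assms by (intro ineq_A_if) auto
  have B: "ineq_B a b c p n x"
    if "a < c" "b < c" "p_upper a b c \<le> p" "p \<le> 2 + max 0 (a + b - c)" "n \<ge> 1" "x \<in> {0<..<1}"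
    for n x
    using that assms by (intro ineq_B_if) auto
  show ?thesis
    using assms by (auto intro!: A B)
qed

end
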